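(* Let $H$ be a numerical semigroup minimally generated by $b_1<\dots<b_m$, with conductor valuation $c$. The ring $S=\Bbbk[[H]]$ is of minimal reduced type if and only if $\max_{x\in \operatorname{PF}(H)\setminus\{c-1\}}x<c-b_1$ (the condition being regarded as satisfied when $\operatorname{PF}(H)=\{c-1\}$).
   Context: $\Bbbk$ is an algebraically closed field of characteristic $0$. A numerical semigroup is a submonoid $H$ of $\mathbb N=\{0,1,2,\dots\}$ with finite complement ($H\neq\mathbb N$, since rings in the paper are non-regular). $S=\Bbbk[[H]]=\Bbbk[[t^{b_1},\dots,t^{b_m}]]\subseteq\overline S=\Bbbk[[t]]$. The conductor valuation $c$ is the least integer with $c+i\in H$ for all $i\ge0$; the conductor ideal of $S$ is $\mathfrak C=t^c\overline S$. The reduced type is $s(S)=\dim_\Bbbk\frac{\mathfrak C+t^{b_1}S}{t^{b_1}S}$; $S$ is of minimal reduced type if $s(S)=1$. The pseudo-Frobenius set is $\operatorname{PF}(H)=\{x\in\mathbb Z\setminus H : x+h\in H\text{ for all }0\ne h\in H\}$; its largest element is $c-1$. *)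

theory Defs
  imports
    "HOL-Computational_Algebra.Computational_Algebra"
    "HOL-Algebra.AbelCoset"
    "Jordan_Normal_Form.VS_Connect"
begin

(* The condition H \<noteq> UNIV excludes the regular ring k[[t]]. *)
definition numerical_semigroup :: "nat set \<Rightarrow> bool" where
  "numerical_semigroup H \<longleftrightarrow>
     0 \<in> H \<and> (\<forall>x\<in>H. \<forall>y\<in>H. x + y \<in> H) \<and> finite (- H) \<and> H \<noteq> UNIV"

inductive_set submonoid_generated :: "nat set \<Rightarrow> nat set" for B :: "nat set" where
  zero: "0 \<in> submonoid_generated B"
| add: "x \<in> submonoid_generated B \<Longrightarrow> b \<in> B \<Longrightarrow> x + b \<in> submonoid_generated B"

definition minimally_generates :: "nat set \<Rightarrow> nat set \<Rightarrow> bool" where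
  "minimally_generates B H \<longleftrightarrow>
     submonoid_generated B = H \<and> (\<forall>B'. B' \<subset> B \<longrightarrow> submonoid_generated B' \<noteq> H)"

definition conductor :: "nat set \<Rightarrow> nat" where
  "conductor H = (LEAST c. \<forall>i. c + i \<in> H)"

definition pseudo_frobenius :: "nat set \<Rightarrow> int set" where
  "pseudo_frobenius H =
     {x. x \<notin> int ` H \<and> (\<forall>h\<in>H. h \<noteq> 0 \<longrightarrow> x + int h \<in> int ` H)}"

(* k[[H]] as a subring of k[[t]]: the power series supported in H. *)
definition semigroup_ring :: "nat set \<Rightarrow> 'k::field fps set" where
  "semigroup_ring H = {f. \<forall>n. fps_nth f n \<noteq> 0 \<longrightarrow> n \<in> H}"

(* A k-subspace V of k[[t]] as a vector space. The ring operations mult and one are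
   part of the record type but play no role in the module structure. *)
definition fps_space :: "'k::field fps set \<Rightarrow> ('k, 'k fps) module" where
  "fps_space V =
     \<lparr>carrier = V, mult = (*), one = 1, zero = 0, add = (+), smult = (\<lambda>a f. fps_const a * f)\<rparr>"

(* The quotient M / W, whose elements are the cosets of W. The coset W is added in smult
   because the elementwise multiple of a coset by the scalar 0 is only {0}. The fields mult
   and one are again irrelevant. *)
definition quotient_space ::
    "('a, 'b, 'm) module_scheme \<Rightarrow> 'b set \<Rightarrow> ('a, 'b set) module" where
  "quotient_space M W =
     \<lparr>carrier = a_rcosets\<^bsub>M\<^esub> W, mult = undefined, one = undefined,
      zero = W, add = set_add M,
      smult = (\<lambda>a A. set_add M W ((\<lambda>x. a \<odot>\<^bsub>M\<^esub> x) ` A))\<rparr>"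

lemma quotient_space_vectorspace:
  assumes "vectorspace K M" and "VectorSpace.subspace K W M"
  shows "vectorspace K (quotient_space M W)"
proof -
  interpret vectorspace K M by (rule assms(1))
  have "LinearCombinations.submodule K W M"
    using assms(2) by (simp add: VectorSpace.subspace_def)
  then interpret W: LinearCombinations.submodule K W M .
  have inv: "\<ominus>\<^bsub>M\<^esub> x \<in> W" if "x \<in> W" for x
    using that W.smult_closed[of "\<ominus>\<^bsub>K\<^esub> \<one>\<^bsub>K\<^esub>" x] W.subset smult_minus_1[of x]
    by (metis R.add.inv_closed R.one_closed a_inv_def subsetD)
  have sub: "subgroup W (add_monoid M)"
    using W.subset inv by (intro add.subgroupI) (auto simp flip: a_inv_def intro: W.m_closed W.zero_closed)
  interpret S: abelian_subgroup W M
    by (rule abelian_subgroupI3) (auto intro: additive_subgroup.intro sub abelian_group_axioms)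
  let ?Q = "quotient_space M W"
  have car: "A \<in> carrier ?Q \<longleftrightarrow> (\<exists>x\<in>carrier M. A = W +>\<^bsub>M\<^esub> x)" for A
    by (auto simp: quotient_space_def A_RCOSETS_def')
  have add: "(W +>\<^bsub>M\<^esub> x) \<oplus>\<^bsub>?Q\<^esub> (W +>\<^bsub>M\<^esub> y) = W +>\<^bsub>M\<^esub> (x \<oplus>\<^bsub>M\<^esub> y)"
    if "x \<in> carrier M" "y \<in> carrier M" for x y
    using that by (simp add: quotient_space_def S.a_rcos_sum)
  have zero: "\<zero>\<^bsub>?Q\<^esub> = W +>\<^bsub>M\<^esub> \<zero>\<^bsub>M\<^esub>"
    using W.subset by (simp add: quotient_space_def)
  have smult: "a \<odot>\<^bsub>?Q\<^esub> (W +>\<^bsub>M\<^esub> x) = W +>\<^bsub>M\<^esub> (a \<odot>\<^bsub>M\<^esub> x)"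
    if a: "a \<in> carrier K" and x: "x \<in> carrier M" for a x
  proof (intro equalityI subsetI)
    fix z assume "z \<in> a \<odot>\<^bsub>?Q\<^esub> (W +>\<^bsub>M\<^esub> x)"
    then obtain w w' where w: "w \<in> W" "w' \<in> W" and z: "z = w \<oplus>\<^bsub>M\<^esub> a \<odot>\<^bsub>M\<^esub> (w' \<oplus>\<^bsub>M\<^esub> x)"
      by (auto simp: quotient_space_def set_add_def' a_r_coset_def')
    have "z = (w \<oplus>\<^bsub>M\<^esub> a \<odot>\<^bsub>M\<^esub> w') \<oplus>\<^bsub>M\<^esub> a \<odot>\<^bsub>M\<^esub> x"
      using z w a x W.subset by (simp add: subset_iff smult_r_distr M.a_assoc)
    moreover have "w \<oplus>\<^bsub>M\<^esub> a \<odot>\<^bsub>M\<^esub> w' \<in> W" using w a by auto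
    ultimately show "z \<in> W +>\<^bsub>M\<^esub> (a \<odot>\<^bsub>M\<^esub> x)" by (auto simp: a_r_coset_def')
  next
    fix z assume "z \<in> W +>\<^bsub>M\<^esub> (a \<odot>\<^bsub>M\<^esub> x)"
    then obtain w where w: "w \<in> W" "z = w \<oplus>\<^bsub>M\<^esub> a \<odot>\<^bsub>M\<^esub> x"
      by (auto simp: a_r_coset_def')
    moreover have "x \<in> W +>\<^bsub>M\<^esub> x" using x by (rule S.a_rcos_self)
    ultimately show "z \<in> a \<odot>\<^bsub>?Q\<^esub> (W +>\<^bsub>M\<^esub> x)"
      by (auto simp: quotient_space_def set_add_def')
  qed
  have "abelian_group ?Q"
  proof (rule abelian_groupI)
    fix A assume "A \<in> carrier ?Q"
    then obtain x where x: "x \<in> carrier M" "A = W +>\<^bsub>M\<^esub> x" unfolding car by blast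
    show "\<exists>B\<in>carrier ?Q. B \<oplus>\<^bsub>?Q\<^esub> A = \<zero>\<^bsub>?Q\<^esub>"
      using x by (intro bexI[of _ "W +>\<^bsub>M\<^esub> (\<ominus>\<^bsub>M\<^esub> x)"]) (auto simp: add zero M.l_neg car)
  qed (auto simp: car add zero M.a_ac)
  then have "Module.module K ?Q"
    by (intro moduleI R.is_cring)
       (auto simp: car add smult smult_l_distr smult_r_distr smult_assoc1)
  then show ?thesis
    by (intro vectorspace.intro) (auto intro: field_axioms)
qed

(* For S = k[[H]] with conductor valuation c and b1 the smallest minimal generator of H:
   the k-dimension of (C + t^b1 S) / t^b1 S, where C = t^c k[[t]] is the conductor ideal. *)
definition reduced_type :: "'k::field fps set \<Rightarrow> nat \<Rightarrow> nat \<Rightarrow> nat" where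
  "reduced_type S c b1 =
     (let C = range (\<lambda>f. fps_X ^ c * f);
          I = (\<lambda>f. fps_X ^ b1 * f) ` S
      in vectorspace.dim class_ring
           (quotient_space (fps_space {f + g | f g. f \<in> C \<and> g \<in> I}) I))"

lemma fps_space_vectorspace:
  fixes V :: "'k::field fps set"
  assumes "0 \<in> V" "\<And>f g. f \<in> V \<Longrightarrow> g \<in> V \<Longrightarrow> f + g \<in> V"
    and "\<And>a f. f \<in> V \<Longrightarrow> fps_const a * f \<in> V"
  shows "vectorspace class_ring (fps_space V)"
proof -
  have "abelian_group (fps_space V)"
  proof (rule abelian_groupI)
    fix f assume f: "f \<in> carrier (fps_space V)"
    have "fps_const (- 1) * f = - f" by (simp flip: fps_const_neg)
    then have "- f \<in> V" using f assms(3)[of f "- 1"] by (simp add: fps_space_def)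
    then show "\<exists>g\<in>carrier (fps_space V). g \<oplus>\<^bsub>fps_space V\<^esub> f = \<zero>\<^bsub>fps_space V\<^esub>"
      by (intro bexI[of _ "- f"]) (auto simp: fps_space_def)
  qed (auto simp: fps_space_def assms algebra_simps)
  then have "Module.module class_ring (fps_space V)"
    by (intro moduleI class_cring.is_cring)
       (auto simp: fps_space_def assms distrib_left distrib_right mult.assoc simp flip: fps_const_add fps_const_mult)
  then show ?thesis
    by (intro vectorspace.intro class_field.field_axioms)
qed

lemma reduced_type_subspace:
  fixes b1 c :: nat
  assumes "numerical_semigroup H"
  defines "I \<equiv> (\<lambda>f. fps_X ^ b1 * f) ` (semigroup_ring H :: 'k::field fps set)"
    and "C \<equiv> range (\<lambda>f. fps_X ^ c * f)"
  shows "VectorSpace.subspace class_ring I (fps_space {f + g | f g. f \<in> C \<and> g \<in> I})"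
proof -
  let ?V = "{f + g | f g. f \<in> C \<and> g \<in> I}"
  have S: "0 \<in> (semigroup_ring H :: 'k fps set)"
    "\<And>f g. f \<in> semigroup_ring H \<Longrightarrow> g \<in> semigroup_ring H \<Longrightarrow> f + g \<in> (semigroup_ring H :: 'k fps set)"
    "\<And>a f. f \<in> semigroup_ring H \<Longrightarrow> fps_const a * f \<in> (semigroup_ring H :: 'k fps set)"
    by (auto simp: semigroup_ring_def) (metis add.right_neutral)
  have I0: "0 \<in> I"
    using S(1) unfolding I_def by (intro image_eqI[of _ _ 0]) auto
  have Ia: "f + g \<in> I" if "f \<in> I" "g \<in> I" for f g
    using that S(2) unfolding I_def by (auto simp flip: distrib_left)
  have Is: "fps_const a * f \<in> I" if "f \<in> I" for a f
    using that S(3) unfolding I_def by (auto simp: mult.left_commute)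
  have C0: "0 \<in> C"
    unfolding C_def by (intro image_eqI[of _ _ 0]) auto
  have Ca: "f + g \<in> C" if "f \<in> C" "g \<in> C" for f g
    using that unfolding C_def by (auto simp flip: distrib_left)
  have Cs: "fps_const a * f \<in> C" if "f \<in> C" for a f
    using that unfolding C_def by (auto simp: mult.left_commute)
  have vs: "vectorspace class_ring (fps_space ?V)"
  proof (rule fps_space_vectorspace)
    show "0 \<in> ?V" using I0 C0 by force
  next
    fix f g assume "f \<in> ?V" "g \<in> ?V"
    then obtain f1 f2 g1 g2 where "f1 \<in> C" "g1 \<in> C" "f2 \<in> I" "g2 \<in> I" "f = f1 + f2" "g = g1 + g2"
      by blast
    then have "f + g = (f1 + g1) + (f2 + g2)" "f1 + g1 \<in> C" "f2 + g2 \<in> I"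
      by (auto intro: Ca Ia)
    then show "f + g \<in> ?V" by blast
  next
    fix a f assume "f \<in> ?V"
    then obtain f1 f2 where "f1 \<in> C" "f2 \<in> I" "f = f1 + f2" by blast
    then have "fps_const a * f = fps_const a * f1 + fps_const a * f2"
      "fps_const a * f1 \<in> C" "fps_const a * f2 \<in> I"
      by (auto intro: Cs Is simp: distrib_left)
    then show "fps_const a * f \<in> ?V" by blast
  qed
  have "I \<subseteq> ?V" using C0 by force
  with vs I0 Ia Is show ?thesis
    by (intro VectorSpace.subspace.intro LinearCombinations.submodule.intro)
       (auto simp: fps_space_def vectorspace_def)
qed

definition minimal_reduced_type :: "'k::field fps set \<Rightarrow> nat \<Rightarrow> nat \<Rightarrow> bool" where
  "minimal_reduced_type S c b1 \<longleftrightarrow> reduced_type S c b1 = 1"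

end

theory Submission
  imports Defs
begin

text \<open>
  The space \<open>\<CC> + t\<^bsup>b\<^sub>1\<^esup> S\<close> consists of the power series supported in
  \<open>{c..} \<union> (b\<^sub>1 + H)\<close>, so modulo \<open>t\<^bsup>b\<^sub>1\<^esup> S\<close> it has a basis of monomials \<open>t\<^sup>n\<close> with
  \<open>n \<ge> c\<close>, \<open>n - b\<^sub>1 \<notin> H\<close>. Hence \<open>s(S)\<close> counts the gaps \<open>x \<ge> c - b\<^sub>1\<close> of \<open>H\<close>. Each of these
  is pseudo-Frobenius, because every nonzero \<open>h \<in> H\<close> is at least \<open>b\<^sub>1\<close> and so \<open>x + h \<ge> c\<close>.
  As \<open>c - 1\<close> is one of them, \<open>s(S) = 1\<close> says that it is the only pseudo-Frobenius number
  that is at least \<open>c - b\<^sub>1\<close>.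
\<close>

section \<open>Spaces of power series with prescribed support\<close>

text \<open>\<open>semigroup_ring\<close> is applied below to arbitrary sets of exponents, so that
  \<CC>, t^{b_1} S and their sum all become spaces of the same kind.\<close>

lemma semigroup_ring_iff: "f \<in> semigroup_ring A \<longleftrightarrow> (\<forall>n. n \<notin> A \<longrightarrow> fps_nth f n = 0)"
  by (auto simp: semigroup_ring_def)

lemma semigroup_ring_subspace:
  assumes "A \<subseteq> B"
  shows "VectorSpace.subspace class_ring (semigroup_ring A :: 'k::field fps set)
    (fps_space (semigroup_ring B))"
proof -
  have "vectorspace class_ring (fps_space (semigroup_ring B :: 'k fps set))"
    by (rule fps_space_vectorspace) (auto simp: semigroup_ring_iff)
  then show ?thesis
    using assms
    by (intro VectorSpace.subspace.intro LinearCombinations.submodule.intro)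
       (auto simp: fps_space_def vectorspace_def semigroup_ring_iff subset_iff)
qed

lemma shift_semigroup_ring:
  "(\<lambda>f. fps_X ^ e * f) ` (semigroup_ring A :: 'k::field fps set) = semigroup_ring ((+) e ` A)"
proof (intro equalityI subsetI)
  fix f :: "'k fps" assume "f \<in> (\<lambda>f. fps_X ^ e * f) ` semigroup_ring A"
  then show "f \<in> semigroup_ring ((+) e ` A)"
    by (auto simp: semigroup_ring_iff fps_X_power_mult_nth) (metis image_eqI le_add_diff_inverse not_less)
next
  fix f :: "'k fps" assume f: "f \<in> semigroup_ring ((+) e ` A)"
  have "f = fps_X ^ e * fps_shift e f"
    using f by (force simp: fps_eq_iff fps_X_power_mult_nth semigroup_ring_iff)
  moreover have "fps_shift e f \<in> semigroup_ring A"
    unfolding semigroup_ring_iff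
  proof (intro allI impI)
    fix n assume "n \<notin> A"
    then have "e + n \<notin> (+) e ` A" by auto
    then show "fps_nth (fps_shift e f) n = 0"
      using f by (simp add: semigroup_ring_iff add.commute)
  qed
  ultimately show "f \<in> (\<lambda>f. fps_X ^ e * f) ` semigroup_ring A" by blast
qed

lemma range_shift: "range (\<lambda>f::'k::field fps. fps_X ^ c * f) = semigroup_ring {c..}"
proof -
  have "(+) c ` UNIV = {c..}"
    by (auto simp: image_def le_iff_add)
  moreover have "semigroup_ring UNIV = (UNIV :: 'k fps set)"
    by (auto simp: semigroup_ring_iff)
  ultimately show ?thesis
    using shift_semigroup_ring[of c UNIV, where 'k = 'k] by simp
qed

lemma semigroup_ring_sum:
  "{f + g |f g. f \<in> semigroup_ring A \<and> g \<in> semigroup_ring B} =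
    (semigroup_ring (A \<union> B) :: 'k::field fps set)"
proof (intro equalityI subsetI)
  fix h :: "'k fps" assume h: "h \<in> semigroup_ring (A \<union> B)"
  \<comment> \<open>Exponents in both sets are assigned to the first summand; the remainder is then
    supported in \<open>B\<close>.\<close>
  let ?f = "Abs_fps (\<lambda>n. if n \<in> A then fps_nth h n else 0)"
  have "h = ?f + (h - ?f)" "?f \<in> semigroup_ring A" "h - ?f \<in> semigroup_ring B"
    using h by (auto simp: semigroup_ring_iff)
  then show "h \<in> {f + g |f g. f \<in> semigroup_ring A \<and> g \<in> semigroup_ring B}" by blast
qed (auto simp: semigroup_ring_iff)

text \<open>The coset of \<open>f\<close> modulo \<open>semigroup_ring A\<close>, encoded by the
  coefficients that survive in the quotient; equality of cosets thus becomes a comparison of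
  coefficients outside \<open>A\<close>.\<close>

definition fps_coset :: "nat set \<Rightarrow> 'k::field fps \<Rightarrow> 'k fps set" where
  "fps_coset A f = {g. \<forall>n. n \<notin> A \<longrightarrow> fps_nth g n = fps_nth f n}"

lemma fps_coset_eq_iff:
  "fps_coset A f = fps_coset A g \<longleftrightarrow> (\<forall>n. n \<notin> A \<longrightarrow> fps_nth f n = fps_nth g n)"
  by (auto simp: fps_coset_def)

lemma a_r_coset_fps_space:
  "semigroup_ring A +>\<^bsub>fps_space V\<^esub> f = fps_coset A f"
proof (intro equalityI subsetI)
  fix g assume g: "g \<in> fps_coset A f"
  then have "g - f \<in> semigroup_ring A" "g = (g - f) + f"
    by (auto simp: semigroup_ring_iff fps_coset_def)
  then show "g \<in> semigroup_ring A +>\<^bsub>fps_space V\<^esub> f"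
    unfolding a_r_coset_def' by (auto simp: fps_space_def intro!: bexI[of _ "g - f"])
qed (auto simp: semigroup_ring_iff fps_coset_def a_r_coset_def' fps_space_def)

lemma set_add_fps_space: "set_add (fps_space V) P Q = {p + q |p q. p \<in> P \<and> q \<in> Q}"
  by (auto simp: set_add_def' fps_space_def)

section \<open>Operations and dimension of a quotient of two such spaces\<close>

context
  fixes A B :: "nat set" and Q
  defines "Q \<equiv> quotient_space (fps_space (semigroup_ring B :: 'k::field fps set)) (semigroup_ring A)"
begin

lemma carrier_fps_quotient: "carrier Q = fps_coset A ` semigroup_ring B"
  by (auto simp: Q_def quotient_space_def A_RCOSETS_def' a_r_coset_fps_space)
     (auto simp: fps_space_def)

lemma zero_fps_quotient: "\<zero>\<^bsub>Q\<^esub> = fps_coset A 0"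
  by (auto simp: Q_def quotient_space_def semigroup_ring_iff fps_coset_def)

lemma add_fps_quotient: "fps_coset A f \<oplus>\<^bsub>Q\<^esub> fps_coset A g = fps_coset A (f + g)"
proof (intro equalityI subsetI)
  fix h assume "h \<in> fps_coset A (f + g)"
  then have "h - g \<in> fps_coset A f" "g \<in> fps_coset A g" "h = (h - g) + g"
    by (auto simp: fps_coset_def)
  then have "\<exists>p q. h = p + q \<and> p \<in> fps_coset A f \<and> q \<in> fps_coset A g" by metis
  then show "h \<in> fps_coset A f \<oplus>\<^bsub>Q\<^esub> fps_coset A g"
    by (simp add: Q_def quotient_space_def set_add_fps_space)
qed (auto simp: Q_def quotient_space_def set_add_fps_space fps_coset_def)

lemma smult_fps_quotient: "a \<odot>\<^bsub>Q\<^esub> fps_coset A f = fps_coset A (fps_const a * f)"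
proof -
  have "a \<odot>\<^bsub>Q\<^esub> fps_coset A f =
      {p + fps_const a * g |p g. p \<in> semigroup_ring A \<and> g \<in> fps_coset A f}"
    unfolding Q_def quotient_space_def by (auto simp: set_add_fps_space) (auto simp: fps_space_def)
  also have "\<dots> = fps_coset A (fps_const a * f)"
  proof (intro equalityI subsetI)
    fix h assume "h \<in> fps_coset A (fps_const a * f)"
    \<comment> \<open>The representative \<open>f\<close> itself is scaled and the summand from
      \<open>semigroup_ring A\<close> absorbs the rest, which covers the scalar 0 as well.\<close>
    then have "h = (h - fps_const a * f) + fps_const a * f"
      "h - fps_const a * f \<in> semigroup_ring A" "f \<in> fps_coset A f"
      by (auto simp: fps_coset_def semigroup_ring_iff)
    then show "h \<in> {p + fps_const a * g |p g. p \<in> semigroup_ring A \<and> g \<in> fps_coset A f}"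
      by blast
  qed (auto simp: fps_coset_def semigroup_ring_iff)
  finally show ?thesis .
qed

text \<open>A coset of a series supported in \<open>B\<close> is determined by its coefficients on
  \<open>B - A\<close>. As this set is finite, these coordinates are those of a finite combination
  of monomial cosets.\<close>

lemma dim_fps_quotient:
  assumes "A \<subseteq> B" and finBA: "finite (B - A)"
  shows "vectorspace.dim class_ring Q = card (B - A)"
proof -
  have "vectorspace class_ring (fps_space (semigroup_ring B :: 'k fps set))"
    by (rule fps_space_vectorspace) (auto simp: semigroup_ring_iff)
  then interpret vectorspace class_ring Q
    unfolding Q_def
    by (rule quotient_space_vectorspace) (rule semigroup_ring_subspace[OF assms(1)])
  define e :: "nat \<Rightarrow> 'k fps set" where "e n = fps_coset A (fps_X ^ n)" for n
  have e_closed: "e n \<in> carrier Q" if "n \<in> B" for n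
    using that by (auto simp: e_def carrier_fps_quotient semigroup_ring_iff)
  have inj: "inj_on e (B - A)"
    by (rule inj_onI) (auto simp: e_def fps_coset_eq_iff fps_X_power_nth split: if_splits)
  \<comment> \<open>Summing over exponents rather than over vectors lets the induction run without
    injectivity of \<open>e\<close>; \<open>lincomb\<close> below reindexes along
    \<open>inj\<close>.\<close>
  have fsum: "(\<Oplus>\<^bsub>Q\<^esub>n\<in>N. a n \<odot>\<^bsub>Q\<^esub> e n) = fps_coset A (Abs_fps (\<lambda>k. if k \<in> N then a k else 0))"
    if "finite N" "N \<subseteq> B" for N and a :: "nat \<Rightarrow> 'k"
    using that
  proof (induction N rule: finite_induct)
    case empty
    then show ?case by (simp add: zero_fps_quotient fps_coset_eq_iff)
  next
    case (insert n N)
    have "(\<lambda>n. a n \<odot>\<^bsub>Q\<^esub> e n) \<in> insert n N \<rightarrow> carrier Q"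
      using insert.prems by (auto intro!: smult_closed e_closed)
    then have "(\<Oplus>\<^bsub>Q\<^esub>n\<in>insert n N. a n \<odot>\<^bsub>Q\<^esub> e n) = a n \<odot>\<^bsub>Q\<^esub> e n \<oplus>\<^bsub>Q\<^esub> (\<Oplus>\<^bsub>Q\<^esub>n\<in>N. a n \<odot>\<^bsub>Q\<^esub> e n)"
      using insert.hyps by (intro M.finsum_insert) auto
    also have "\<dots> = fps_coset A (Abs_fps (\<lambda>k. if k \<in> insert n N then a k else 0))"
      using insert by (auto simp: e_def smult_fps_quotient add_fps_quotient fps_coset_eq_iff)
    finally show ?case .
  qed
  have lincomb: "lincomb a (e ` (B - A)) =
      fps_coset A (Abs_fps (\<lambda>k. if k \<in> B - A then a (e k) else 0))" for a
  proof -
    have "lincomb a (e ` (B - A)) = (\<Oplus>\<^bsub>Q\<^esub>n\<in>B - A. a (e n) \<odot>\<^bsub>Q\<^esub> e n)"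
      unfolding lincomb_def
      by (rule M.finsum_reindex[OF _ inj]) (auto intro!: smult_closed e_closed)
    then show ?thesis
      using fsum[OF finBA, of "\<lambda>n. a (e n)"] by simp
  qed
  have "basis (e ` (B - A))"
    unfolding basis_def
  proof (intro conjI)
    show car: "e ` (B - A) \<subseteq> carrier Q" by (auto intro: e_closed)
    show "\<not> lin_dep (e ` (B - A))"
    proof (rule finite_lin_indpt2)
      fix a assume "lincomb a (e ` (B - A)) = \<zero>\<^bsub>Q\<^esub>"
      then have "\<forall>n. n \<notin> A \<longrightarrow> (if n \<in> B - A then a (e n) else 0) = 0"
        unfolding lincomb zero_fps_quotient fps_coset_eq_iff by simp
      then show "\<forall>v\<in>e ` (B - A). a v = \<zero>\<^bsub>class_ring\<^esub>"
        by auto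
    qed (use finBA car in auto)
    show "gen_set (e ` (B - A))"
    proof
      show "span (e ` (B - A)) \<subseteq> carrier Q" using car by (rule span_is_subset2)
      show "carrier Q \<subseteq> span (e ` (B - A))"
      proof
        fix v assume "v \<in> carrier Q"
        then obtain f where f: "f \<in> semigroup_ring B" "v = fps_coset A f"
          by (auto simp: carrier_fps_quotient)
        \<comment> \<open>A linear combination takes its coefficients as a function of vectors, so
          the exponent is recovered from the vector by inverting \<open>e\<close>.\<close>
        define a where "a w = fps_nth f (the_inv_into (B - A) e w)" for w
        have "a (e n) = fps_nth f n" if "n \<in> B - A" for n
          using that by (simp add: a_def the_inv_into_f_f[OF inj])
        then have "v = lincomb a (e ` (B - A))"
          using f by (auto simp: lincomb fps_coset_eq_iff semigroup_ring_iff)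
        then show "v \<in> span (e ` (B - A))"
          using finBA car by (auto simp: finite_span)
      qed
    qed
  qed
  then have "dim = card (e ` (B - A))"
    by (intro dim_basis) (use finBA in auto)
  then show ?thesis by (simp add: card_image[OF inj])
qed

end

text \<open>Numerator and denominator have supports \<open>{c..} \<union> (+) e\<close>
  H\<open>and\<close>(+) e \<open>H\<close>, and the dimension counts the difference of the
  supports.\<close>

lemma reduced_type_semigroup_ring:
  assumes "finite ({c..} - (+) e ` H)"
  shows "reduced_type (semigroup_ring H :: 'k::field fps set) c e = card ({c..} - (+) e ` H)"
proof -
  have "reduced_type (semigroup_ring H :: 'k fps set) c e =
    vectorspace.dim class_ring (quotient_space
      (fps_space (semigroup_ring ({c..} \<union> (+) e ` H) :: 'k fps set)) (semigroup_ring ((+) e ` H)))"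
    by (simp only: reduced_type_def Let_def range_shift shift_semigroup_ring semigroup_ring_sum)
  also have "\<dots> = card (({c..} \<union> (+) e ` H) - (+) e ` H)"
    by (rule dim_fps_quotient) (use assms in \<open>auto simp: Un_Diff\<close>)
  finally show ?thesis by (simp add: Un_Diff)
qed

section \<open>Numerical semigroups\<close>

lemma submonoid_generated_eq_0_or_ge:
  assumes "x \<in> submonoid_generated B" "\<And>b. b \<in> B \<Longrightarrow> e \<le> b"
  shows "x = 0 \<or> e \<le> x"
  using assms by (induction) (auto intro: trans_le_add2)

lemma submonoid_generated_superset: "b \<in> B \<Longrightarrow> b \<in> submonoid_generated B"
  using submonoid_generated.add[OF submonoid_generated.zero, of b B] by simp

lemma submonoid_generated_remove_0: "submonoid_generated (B - {0}) = submonoid_generated B"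
proof (intro equalityI subsetI)
  fix x assume "x \<in> submonoid_generated (B - {0})"
  then show "x \<in> submonoid_generated B"
    by induction (auto intro: submonoid_generated.intros)
next
  fix x assume "x \<in> submonoid_generated B"
  then show "x \<in> submonoid_generated (B - {0})"
  proof induction
    case (add x b)
    then show ?case
      by (cases "b = 0") (auto intro: submonoid_generated.intros)
  qed (rule submonoid_generated.zero)
qed

text \<open>A generator 0 could be dropped without changing the generated monoid, against
  minimality. This later makes \<open>b 1\<close> positive.\<close>

lemma zero_notin_minimal_generators:
  assumes "minimally_generates B H"
  shows "0 \<notin> B"
  using assms submonoid_generated_remove_0[of B] unfolding minimally_generates_def
  by (metis Diff_subset Diff_iff insertI1 psubsetI)

section \<open>The conductor and the pseudo-Frobenius numbers\<close>

lemma ge_conductor_in: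
  assumes "numerical_semigroup H" "conductor H \<le> n"
  shows "n \<in> H"
proof -
  have "finite (- H)" using assms(1) by (simp add: numerical_semigroup_def)
  then obtain k where k: "\<forall>n\<in>-H. n < k" using finite_nat_set_iff_bounded by auto
  then have "\<forall>i. k + i \<in> H" using not_add_less1 by blast
  \<comment> \<open>Any strict upper bound \<open>k\<close> of the gaps shows that the
    \<open>LEAST\<close> in \<open>conductor\<close> is attained.\<close>
  then have "\<forall>i. conductor H + i \<in> H" unfolding conductor_def by (rule LeastI)
  then show ?thesis using assms(2) le_Suc_ex by blast
qed

lemma conductor_pos:
  assumes "numerical_semigroup H"
  shows "0 < conductor H"
  using assms ge_conductor_in[OF assms] by (metis UNIV_eq_I gr0I le0 numerical_semigroup_def)

lemma conductor_minus_one_notin: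
  assumes "numerical_semigroup H"
  shows "conductor H - 1 \<notin> H"
proof
  assume "conductor H - 1 \<in> H"
  \<comment> \<open>The case \<open>i = 0\<close> is the assumption; every larger \<open>i\<close>
    reaches the conductor, since it is positive and the subtraction is exact.\<close>
  then have "\<forall>i. (conductor H - 1) + i \<in> H"
    using ge_conductor_in[OF assms] conductor_pos[OF assms]
    by (metis One_nat_def Suc_pred add_Suc_shift le_add1 add_0_right old.nat.exhaust)
  then have "conductor H \<le> conductor H - 1"
    unfolding conductor_def by (rule Least_le)
  then show False using conductor_pos[OF assms] by simp
qed

lemma pseudo_frobenius_less_conductor:
  assumes "numerical_semigroup H" "x \<in> pseudo_frobenius H"
  shows "x < int (conductor H)"
proof (rule ccontr)
  assume "\<not> x < int (conductor H)"
  then have "nat x \<in> H" "x = int (nat x)"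
    using ge_conductor_in[OF assms(1), of "nat x"] by auto
  then have "x \<in> int ` H" by (metis imageI)
  then show False using assms(2) by (simp add: pseudo_frobenius_def)
qed

lemma finite_pseudo_frobenius:
  assumes "numerical_semigroup H"
  shows "finite (pseudo_frobenius H)"
proof -
  let ?c = "conductor H"
  have "pseudo_frobenius H \<subseteq> {- int ?c..int ?c}"
  proof
    fix x assume x: "x \<in> pseudo_frobenius H"
    \<comment> \<open>The conductor is a nonzero element of \<open>H\<close>, so x + c is
      nonnegative; this crude lower bound suffices for finiteness.\<close>
    then have "x + int ?c \<in> int ` H"
      using ge_conductor_in[OF assms, of ?c] conductor_pos[OF assms]
      by (auto simp: pseudo_frobenius_def)
    then show "x \<in> {- int ?c..int ?c}"
      using pseudo_frobenius_less_conductor[OF assms x] by auto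
  qed
  then show ?thesis by (rule finite_subset) simp
qed

lemma gap_pseudo_frobenius:
  assumes "numerical_semigroup H" "\<And>h. h \<in> H \<Longrightarrow> h \<noteq> 0 \<Longrightarrow> e \<le> h"
    and "x \<notin> H" "conductor H \<le> x + e"
  shows "int x \<in> pseudo_frobenius H"
proof -
  have "x + h \<in> H" if "h \<in> H" "h \<noteq> 0" for h
    using that assms(2)[of h] assms(4) by (intro ge_conductor_in[OF assms(1)]) auto
  then show ?thesis using assms(3) by (auto simp: pseudo_frobenius_def simp flip: of_nat_add)
qed

text \<open>The shift x \<mapsto> x + e identifies the gaps x \<ge> c - e with the counted set.
  These gaps are exactly the pseudo-Frobenius numbers in that range, and c - 1 is always among
  them.\<close>

lemma card_eq_one_iff_pseudo_frobenius:
  assumes H: "numerical_semigroup H" and "e \<in> H" "e \<noteq> 0"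
    and min: "\<And>h. h \<in> H \<Longrightarrow> h \<noteq> 0 \<Longrightarrow> e \<le> h"
  defines "c \<equiv> conductor H"
  shows "card ({c..} - (+) e ` H) = 1 \<longleftrightarrow>
    (\<forall>x\<in>pseudo_frobenius H - {int c - 1}. x < int c - int e)"
proof -
  let ?N = "{c..} - (+) e ` H"
  have c: "0 < c" unfolding c_def by (rule conductor_pos[OF H])
  have cH: "n \<in> H" if "c \<le> n" for n using ge_conductor_in[OF H] that by (simp add: c_def)
  \<comment> \<open>\<open>c\<close> is itself a nonzero element of \<open>H\<close>. Hence c - e is
    nonnegative, which later makes \<open>n - e\<close> exact and excludes negative pseudo-Frobenius
    numbers from the range.\<close>
  have ec: "e \<le> c" using min cH c by simp
  have N_iff: "x + e \<in> ?N \<longleftrightarrow> c \<le> x + e \<and> x \<notin> H" for x by (auto simp: add.commute)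
  have top: "c - 1 + e \<in> ?N"
    by (rule iffD2[OF N_iff]) (use conductor_minus_one_notin[OF H] assms(3) c in \<open>auto simp: c_def\<close>)
  have "card ?N = 1 \<longleftrightarrow> ?N = {c - 1 + e}"
  proof
    assume "card ?N = 1"
    then obtain n where "?N = {n}" by (rule card_1_singletonE)
    with top show "?N = {c - 1 + e}" by (metis singletonD)
  qed simp
  also have "\<dots> \<longleftrightarrow> (\<forall>x. c \<le> x + e \<longrightarrow> x \<notin> H \<longrightarrow> x = c - 1)"
  proof
    assume N: "?N = {c - 1 + e}"
    show "\<forall>x. c \<le> x + e \<longrightarrow> x \<notin> H \<longrightarrow> x = c - 1"
      using N_iff unfolding N by simp
  next
    assume x: "\<forall>x. c \<le> x + e \<longrightarrow> x \<notin> H \<longrightarrow> x = c - 1"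
    have "n = c - 1 + e" if "n \<in> ?N" for n
    proof -
      have "n = (n - e) + e" using that ec by simp
      then show ?thesis using x that N_iff[of "n - e"] by metis
    qed
    then have "?N \<subseteq> {c - 1 + e}" by (intro subsetI) (simp only: singleton_iff)
    moreover have "{c - 1 + e} \<subseteq> ?N" using top by (simp only: insert_subset empty_subsetI)
    ultimately show "?N = {c - 1 + e}" by (rule subset_antisym)
  qed
  also have "\<dots> \<longleftrightarrow> (\<forall>x\<in>pseudo_frobenius H - {int c - 1}. x < int c - int e)"
  proof
    assume gaps: "\<forall>x. c \<le> x + e \<longrightarrow> x \<notin> H \<longrightarrow> x = c - 1"
    show "\<forall>x\<in>pseudo_frobenius H - {int c - 1}. x < int c - int e"
    proof (rule ballI, rule ccontr)
      fix x assume x: "x \<in> pseudo_frobenius H - {int c - 1}" "\<not> x < int c - int e"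
      then obtain n where "x = int n" using ec by (cases x) auto
      then have "n \<notin> H" "n \<noteq> c - 1" "c \<le> n + e"
        using x c by (auto simp: pseudo_frobenius_def)
      then show False using gaps by blast
    qed
  next
    assume pf: "\<forall>x\<in>pseudo_frobenius H - {int c - 1}. x < int c - int e"
    show "\<forall>x. c \<le> x + e \<longrightarrow> x \<notin> H \<longrightarrow> x = c - 1"
    proof (intro allI impI, rule ccontr)
      fix x assume x: "c \<le> x + e" "x \<notin> H" "x \<noteq> c - 1"
      then have "int x \<in> pseudo_frobenius H - {int c - 1}"
        using gap_pseudo_frobenius[OF H min] by (auto simp: c_def)
      with pf have "int x < int c - int e" by (rule bspec)
      then show False using x(1) by simp
    qed
  qed
  finally show ?thesis .
qed

theorem proposition3p8:
  fixes H :: "nat set" and b :: "nat \<Rightarrow> nat" and m c :: nat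
    and S :: "'k::{alg_closed_field, field_char_0} fps set"
  assumes "numerical_semigroup H"
    and "strict_mono_on {1..m} b"
    and "minimally_generates (b ` {1..m}) H"
    and "c = conductor H"
    and "S = semigroup_ring H"
  shows "minimal_reduced_type S c (b 1) \<longleftrightarrow>
    (pseudo_frobenius H = {int c - 1} \<or>
     Max (pseudo_frobenius H - {int c - 1}) < int c - int (b 1))"
proof -
  have gen: "submonoid_generated (b ` {1..m}) = H"
    using assms(3) by (simp add: minimally_generates_def)
  have cH: "n \<in> H" if "c \<le> n" for n using ge_conductor_in[OF assms(1)] that assms(4) by simp
  have min: "b 1 \<le> h" if "h \<in> H" "h \<noteq> 0" for h
  proof -
    have "b 1 \<le> y" if "y \<in> b ` {1..m}" for y
      using that strict_mono_on_leD[OF assms(2), of 1] by auto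
    then show ?thesis
      using that submonoid_generated_eq_0_or_ge[of h "b ` {1..m}" "b 1"] gen by auto
  qed
  \<comment> \<open>Only for m \<ge> 1 is \<open>b 1\<close> one of the generators; without
    generators \<open>H\<close> would be {0}, although it contains \<open>Suc c\<close>.\<close>
  have "m \<noteq> 0"
  proof
    assume "m = 0"
    then have "H = {0}"
      using gen by (auto elim: submonoid_generated.cases intro: submonoid_generated.zero)
    then show False using cH[of "Suc c"] by simp
  qed
  then have b1: "b 1 \<in> b ` {1..m}" by auto
  then have b1H: "b 1 \<in> H" and b1_pos: "b 1 \<noteq> 0"
    using submonoid_generated_superset gen zero_notin_minimal_generators[OF assms(3)] by metis+
  have fin: "finite ({c..} - (+) (b 1) ` H)"
  proof (rule finite_subset)
    show "{c..} - (+) (b 1) ` H \<subseteq> {..c + b 1}"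
    proof
      fix n assume n: "n \<in> {c..} - (+) (b 1) ` H"
      \<comment> \<open>Beyond c + b_1, subtracting b_1 stays above the conductor, so such an
        \<open>n\<close> lies in the shifted semigroup.\<close>
      have "n = b 1 + (n - b 1)" "n - b 1 \<in> H" if "c + b 1 < n"
        using that cH[of "n - b 1"] by auto
      then show "n \<in> {..c + b 1}" using n by (metis DiffD2 atMost_iff image_eqI not_le)
    qed
  qed simp
  let ?P = "pseudo_frobenius H - {int c - 1}"
  have "int (c - 1) \<in> pseudo_frobenius H"
    using gap_pseudo_frobenius[OF assms(1) min conductor_minus_one_notin[OF assms(1)]] b1_pos assms(4)
    by auto
  then have top: "int c - 1 \<in> pseudo_frobenius H"
    using conductor_pos[OF assms(1)] assms(4) by (simp add: of_nat_diff)
  have "minimal_reduced_type S c (b 1) \<longleftrightarrow> card ({c..} - (+) (b 1) ` H) = 1"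
    unfolding minimal_reduced_type_def assms(5) reduced_type_semigroup_ring[OF fin] ..
  also have "\<dots> \<longleftrightarrow> (\<forall>x\<in>?P. x < int c - int (b 1))"
    using card_eq_one_iff_pseudo_frobenius[OF assms(1) b1H b1_pos min] by (simp add: assms(4))
  \<comment> \<open>\<open>Max\<close> says nothing useful on the empty set, so that case must fall
    under the first disjunct; \<open>top\<close> ensures it by ruling out an empty
    \<open>pseudo_frobenius H\<close>.\<close>
  also have "\<dots> \<longleftrightarrow> pseudo_frobenius H = {int c - 1} \<or> Max ?P < int c - int (b 1)"
  proof (cases "?P = {}")
    case True
    then have "pseudo_frobenius H = {int c - 1}" using top by blast
    then show ?thesis by simp
  next
    case False
    then show ?thesis using finite_pseudo_frobenius[OF assms(1)] by auto
  qed
  finally show ?thesis .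
qed

end
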